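(* Let $X$ be a metric space, $Y$ a real Hausdorff topological vector space, $K\subset Y$ a proper convex cone, and $H\subset K\setminus(-K)$ a nonempty set such that $H+K$ is convex. Let $\mathcal{A}\subset X\times2^Y$, put $\mathcal{A}_2:=\{A\in2^Y\mid\exists x\in X:(x,A)\in\mathcal{A}\}$ and $Y_{\mathcal{A}}:=\bigcup\mathcal{A}_2$, and assume $Y_{\mathcal{A}}\neq\emptyset$. Consider the condition $$( * )\qquad\forall y\in Y,\ \exists\varepsilon>0:\ Y_{\mathcal{A}}\cap(y-\varepsilon H-K)=\emptyset.$$ (i) Assume that either (a) $0\notin\operatorname{cl}_{seq}(H+K)$ and $Y_{\mathcal{A}}$ is quasi $K$-bounded, or (b) $0\notin\operatorname{cl}(H+K)$ and $Y_{\mathcal{A}}$ is $K$-bounded; then $( * )$ holds. (ii) Assume that either (a) there exists $z^*\in K^+$ such that $\inf z^*(Y_{\mathcal{A}})>-\infty$ and $\inf z^*(H)>0$, or (b) $Y_{\mathcal{A}}$ is $K^+$-bounded and for every sequence $(h_n)\subseteq H$ there exists $z^*\in K^+$ with $\limsup z^*(h_n)>0$. Then $( * )$ holds. (iii) Assume that $H$ is sequentially compact. If there exist a convex cone $C\subset Y$ and a bounded set $B\subset Y$ such that $K\subset C$, $H\subset\operatorname{int}C$ and $B\not\subset A+C$ for every $A\in\mathcal{A}_2$, then $( * )$ holds; in particular, if $H\subset\operatorname{int}K$ and there exists a bounded set $B\subset Y$ with $B\not\subset A+K$ for every $A\in\mathcal{A}_2$, then $( * )$ holds. (iv) Assume that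 $( * )$ holds. Then there exists a bounded set $B\subset Y$ with $B\not\subset A+K$ for every $A\in\mathcal{A}_2$, and for every nonempty set $A_0\in\mathcal{A}_2$ there exists $\varepsilon>0$ such that $A_0\not\subset A+\varepsilon H+K$ for every $A\in\mathcal{A}_2$.
   Context: A proper convex cone $K$ satisfies $0\in K$, $K+K\subset K$, $tK\subset K$ for $t\ge0$, and $\{0\}\ne K\ne Y$. $K^+=\{y^*\in Y^*\mid y^*(y)\ge0\ \forall y\in K\}$, $Y^*$ being the topological dual. Sums of sets are Minkowski sums with $\emptyset+A=\emptyset$. For $E\subset Y$: $\operatorname{cl}_{seq}E$ is the set of limits of convergent sequences from $E$; $E$ is sequentially compact if every sequence in $E$ has a subsequence converging to an element of $E$; $E$ is quasi $K$-bounded if $E\subset B+K$ for some bounded $B\subset Y$; $E$ is $K$-bounded if for every neighborhood $U$ of $0$ there is $\lambda>0$ with $E\subset\lambda U+K$; $E$ is $K^+$-bounded if $y^*(E)$ is bounded from below for every $y^*\in K^+$. *)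

theory Defs
  imports "HOL-Analysis.Analysis" "HOL-Library.Set_Algebras"
begin

text \<open>
  Addition of sets is the Minkowski sum of \<^theory>\<open>HOL-Library.Set_Algebras\<close>, so that
  an empty summand gives the empty set.  Subtraction of sets is set difference in HOL, so
  Minkowski differences and \<open>-K\<close> are always written out (\<open>uminus ` K\<close>).
\<close>

class hausdorff_tvs = real_vector + topological_ab_group_add + t2_space +
  assumes tendsto_scaleR_Pair:
    "filterlim (\<lambda>p. fst p *\<^sub>R snd p) (nhds (t *\<^sub>R y)) (nhds t \<times>\<^sub>F nhds y)"

instance real_normed_vector \<subseteq> hausdorff_tvs
proof
  fix t :: real and y :: 'a
  show "filterlim (\<lambda>p. fst p *\<^sub>R snd p) (nhds (t *\<^sub>R y)) (nhds t \<times>\<^sub>F nhds y)"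
    by (intro tendsto_scaleR filterlim_fst filterlim_snd)
qed

lemma continuous_on_scaleR_tvs:
  "continuous_on UNIV (\<lambda>p :: real \<times> 'y::hausdorff_tvs. fst p *\<^sub>R snd p)"
proof -
  have "((\<lambda>p. fst p *\<^sub>R snd p) \<longlongrightarrow> fst q *\<^sub>R snd q) (at q)" for q :: "real \<times> 'y"
    using tendsto_scaleR_Pair[of "fst q" "snd q"]
    unfolding nhds_prod[symmetric] prod.collapse
    by (rule tendsto_mono[rotated]) (simp add: at_within_def)
  then show ?thesis
    by (simp add: continuous_on_eq_continuous_at isCont_def)
qed

text \<open>The library predicate \<^const>\<open>convex_cone\<close> applied to \<open>K\<close> says \<open>0 \<in> K\<close>, \<open>K + K \<subseteq> K\<close> and \<open>tK \<subseteq> K\<close> for \<open>t \<ge> 0\<close>; see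
  the library lemma \<open>convex_cone_iff\<close>.\<close>

definition proper_convex_cone :: "'y::hausdorff_tvs set \<Rightarrow> bool" where
  "proper_convex_cone K \<longleftrightarrow> convex_cone K \<and> K \<noteq> {0} \<and> K \<noteq> UNIV"

definition topological_dual :: "('y::hausdorff_tvs \<Rightarrow> real) set" where
  "topological_dual = {f. linear f \<and> continuous_on UNIV f}"

definition dual_cone :: "'y::hausdorff_tvs set \<Rightarrow> ('y \<Rightarrow> real) set" where
  "dual_cone K = {f \<in> topological_dual. \<forall>y\<in>K. 0 \<le> f y}"

definition seq_closure :: "'y::hausdorff_tvs set \<Rightarrow> 'y set" where
  "seq_closure E = {l. \<exists>s::nat \<Rightarrow> 'y. (\<forall>n. s n \<in> E) \<and> s \<longlonglongrightarrow> l}"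

text \<open>Boundedness in the sense of topological vector spaces; \<open>0 \<in> interior U\<close> says that
  \<open>U\<close> is a neighbourhood of \<open>0\<close>.\<close>

definition tvs_bounded :: "'y::hausdorff_tvs set \<Rightarrow> bool" where
  "tvs_bounded E \<longleftrightarrow> (\<forall>U. 0 \<in> interior U \<longrightarrow> (\<exists>r>0. E \<subseteq> (\<lambda>u. r *\<^sub>R u) ` U))"

definition quasi_cone_bounded :: "'y::hausdorff_tvs set \<Rightarrow> 'y set \<Rightarrow> bool" where
  "quasi_cone_bounded K E \<longleftrightarrow> (\<exists>B. tvs_bounded B \<and> E \<subseteq> B + K)"

definition cone_bounded :: "'y::hausdorff_tvs set \<Rightarrow> 'y set \<Rightarrow> bool" where
  "cone_bounded K E \<longleftrightarrow> (\<forall>U. 0 \<in> interior U \<longrightarrow> (\<exists>r>0. E \<subseteq> (\<lambda>u. r *\<^sub>R u) ` U + K))"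

definition dual_cone_bounded :: "'y::hausdorff_tvs set \<Rightarrow> 'y set \<Rightarrow> bool" where
  "dual_cone_bounded K E \<longleftrightarrow> (\<forall>f\<in>dual_cone K. bdd_below (f ` E))"

definition second_proj :: "('x \<times> 'y set) set \<Rightarrow> 'y set set" where
  "second_proj \<A> = {A. \<exists>x. (x, A) \<in> \<A>}"

definition second_union :: "('x \<times> 'y set) set \<Rightarrow> 'y set" where
  "second_union \<A> = \<Union> (second_proj \<A>)"

definition cond_star :: "'y::hausdorff_tvs set \<Rightarrow> 'y set \<Rightarrow> ('x \<times> 'y set) set \<Rightarrow> bool" where
  "cond_star K H \<A> \<longleftrightarrow>
     (\<forall>y. \<exists>\<epsilon>>0. second_union \<A> \<inter> {y - \<epsilon> *\<^sub>R h - k | h k. h \<in> H \<and> k \<in> K} = {})"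

end

theory Submission
  imports Defs
begin

text \<open>
  If \<open>cond_star\<close> fails at \<open>y\<close>, there are \<open>h n \<in> H\<close> and \<open>k n \<in> K\<close> such that every
  \<open>z n = y - (n + 1) h n - k n\<close> lies in the union of the second components.  Under (i), dividing
  the resulting inclusion by \<open>n + 1\<close> puts vectors tending to \<open>0\<close> into \<open>H + K\<close>; under (ii), a
  functional is unbounded below along \<open>z\<close>; under (iii), one picks \<open>b n \<in> B\<close> outside \<open>z n + C\<close>, while
  \<open>(b n - y) / (n + 1) + h n\<close> accumulates at a point of \<open>interior C\<close>.  For (iv), singletons serve
  as the bounded sets.
\<close>

section \<open>Scalar multiplication and bounded sets\<close>

lemma tendsto_scaleR_tvs:
  fixes g :: "'a \<Rightarrow> 'y::hausdorff_tvs"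
  assumes "(f \<longlongrightarrow> t) F" "(g \<longlongrightarrow> y) F"
  shows "((\<lambda>x. f x *\<^sub>R g x) \<longlongrightarrow> t *\<^sub>R y) F"
proof -
  have "filterlim (\<lambda>x. (f x, g x)) (nhds t \<times>\<^sub>F nhds y) F"
    using assms by (rule filterlim_Pair)
  from filterlim_compose[OF tendsto_scaleR_Pair this] show ?thesis by simp
qed

text \<open>By joint continuity at the origin, small scalars times vectors from a suitable
  neighbourhood of 0 land in \<open>U\<close>; a fixed multiple \<open>r\<close> of that
  neighbourhood covers \<open>B\<close>.\<close>

lemma tendsto_scaleR_bounded:
  fixes b :: "nat \<Rightarrow> 'y::hausdorff_tvs"
  assumes B: "tvs_bounded B" and b: "\<And>n. b n \<in> B" and s: "s \<longlonglongrightarrow> 0"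
  shows "(\<lambda>n. s n *\<^sub>R b n) \<longlonglongrightarrow> 0"
proof (rule topological_tendstoI)
  fix U :: "'y set"
  assume U: "open U" "0 \<in> U"
  have "((\<lambda>p. fst p *\<^sub>R snd p) \<longlongrightarrow> (0::'y)) (nhds 0 \<times>\<^sub>F nhds 0)"
    using tendsto_scaleR_Pair[of 0 "0::'y"] by simp
  then have "eventually (\<lambda>p. fst p *\<^sub>R snd p \<in> U) (nhds 0 \<times>\<^sub>F nhds 0)"
    using U by (rule topological_tendstoD)
  then obtain P Q where P: "eventually P (nhds 0)" and Q: "eventually Q (nhds 0)"
    and PQ: "\<And>t v. P t \<Longrightarrow> Q v \<Longrightarrow> t *\<^sub>R v \<in> U"
    unfolding eventually_prod_filter by auto
  have "0 \<in> interior {v. Q v}"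
    using Q by (auto simp: eventually_nhds interior_def)
  then obtain r where "B \<subseteq> (\<lambda>u. r *\<^sub>R u) ` {v. Q v}"
    using B unfolding tvs_bounded_def by blast
  then have "\<exists>v. Q v \<and> b n = r *\<^sub>R v" for n
    using b[of n] by blast
  then obtain v where v: "\<And>n. Q (v n)" "\<And>n. b n = r *\<^sub>R v n"
    by metis
  \<comment> \<open>\<open>r\<close> moves from the vector to the scalar:
    \<open>s n *\<^sub>R b n\<close> equals \<open>(s n * r) *\<^sub>R v n\<close>.\<close>
  have "(\<lambda>n. s n * r) \<longlonglongrightarrow> 0"
    using s by (rule tendsto_mult_left_zero)
  from eventually_compose_filterlim[OF P this]
  show "eventually (\<lambda>n. s n *\<^sub>R b n \<in> U) sequentially"
    by eventually_elim (use PQ v in \<open>metis scaleR_scaleR\<close>)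
qed

text \<open>The vectors y / (n + 1) tend to 0, so one of them lies in \<open>U\<close>, and n + 1 is
  the required factor.\<close>

lemma tvs_bounded_singleton: "tvs_bounded {y::'y::hausdorff_tvs}"
  unfolding tvs_bounded_def
proof (intro allI impI)
  fix U :: "'y set"
  assume U: "0 \<in> interior U"
  have "((\<lambda>n. inverse (real (Suc n)) *\<^sub>R y) \<longlonglongrightarrow> 0 *\<^sub>R y)"
    by (intro tendsto_scaleR_tvs LIMSEQ_inverse_real_of_nat tendsto_const)
  then have "eventually (\<lambda>n. inverse (real (Suc n)) *\<^sub>R y \<in> interior U) sequentially"
    using U by (intro topological_tendstoD) auto
  then obtain n where "inverse (real (Suc n)) *\<^sub>R y \<in> interior U"
    by (meson eventually_sequentially order_refl)
  then have "inverse (real (Suc n)) *\<^sub>R y \<in> U"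
    using interior_subset by blast
  moreover have "y = real (Suc n) *\<^sub>R (inverse (real (Suc n)) *\<^sub>R y)"
    by simp
  ultimately show "\<exists>r>0. {y} \<subseteq> (\<lambda>u. r *\<^sub>R u) ` U"
    by (metis empty_subsetI image_eqI insert_subset of_nat_0_less_iff zero_less_Suc)
qed

section \<open>Boundedness with respect to the cone, statement (i)\<close>

text \<open>Failure at \<open>y\<close> gives witnesses for every positive \<epsilon>; only the
  values n + 1 are kept, which are positive already at n = 0.\<close>

lemma not_cond_starE:
  assumes "\<not> cond_star K H \<A>"
  obtains y h k where "\<And>n::nat. h n \<in> H" "\<And>n. k n \<in> K"
    "\<And>n. y - real (Suc n) *\<^sub>R h n - k n \<in> second_union \<A>"
proof -
  obtain y where "\<And>e. e > 0 \<Longrightarrow>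
      second_union \<A> \<inter> {y - e *\<^sub>R h - k | h k. h \<in> H \<and> k \<in> K} \<noteq> {}"
    using assms unfolding cond_star_def by blast
  then have "\<exists>h k. h \<in> H \<and> k \<in> K \<and> y - e *\<^sub>R h - k \<in> second_union \<A>" if "e > 0" for e
    using that by blast
  then have "\<forall>n. \<exists>h k. h \<in> H \<and> k \<in> K \<and> y - real (Suc n) *\<^sub>R h - k \<in> second_union \<A>"
    by simp
  then show thesis
    using that by metis
qed

text \<open>Dividing y - b = (n + 1) h + (k + k') by n + 1 leaves \<open>h\<close> with coefficient
  1, while the cone part stays in \<open>K\<close>. Both cases of (i) use this.\<close>

lemma scaled_diff_in_cone_sum:
  assumes K: "convex_cone K" and "h \<in> H" "k \<in> K" "k' \<in> K"
    and eq: "y - real (Suc n) *\<^sub>R h - k = b + k'"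
  shows "inverse (real (Suc n)) *\<^sub>R y - inverse (real (Suc n)) *\<^sub>R b \<in> H + K"
proof -
  have "y - b = real (Suc n) *\<^sub>R h + (k + k')"
    using eq by (simp add: algebra_simps)
  then have "inverse (real (Suc n)) *\<^sub>R (y - b) = h + inverse (real (Suc n)) *\<^sub>R (k + k')"
    by (simp add: scaleR_add_right)
  moreover have "inverse (real (Suc n)) *\<^sub>R (k + k') \<in> K"
    using K assms(3,4) by (simp add: convex_cone_iff)
  ultimately show ?thesis
    using \<open>h \<in> H\<close> by (simp add: scaleR_diff_right set_plus_intro)
qed

text \<open>One bounded set serves all n, so the scaled differences form a sequence in
  \<open>H + K\<close> tending to 0.\<close>

lemma cond_star_if_quasi_cone_bounded:
  assumes K: "convex_cone K" and 0: "0 \<notin> seq_closure (H + K)"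
    and "quasi_cone_bounded K (second_union \<A>)"
  shows "cond_star K H \<A>"
proof (rule ccontr)
  assume "\<not> cond_star K H \<A>"
  then obtain y h k where hk: "\<And>n::nat. h n \<in> H" "\<And>n. k n \<in> K"
    "\<And>n. y - real (Suc n) *\<^sub>R h n - k n \<in> second_union \<A>"
    by (rule not_cond_starE) blast
  obtain B where B: "tvs_bounded B" "second_union \<A> \<subseteq> B + K"
    using assms(3) unfolding quasi_cone_bounded_def by blast
  have "\<exists>b k'. b \<in> B \<and> k' \<in> K \<and> y - real (Suc n) *\<^sub>R h n - k n = b + k'" for n
    using hk(3)[of n] B(2) by (blast elim: set_plus_elim)
  then obtain b k' where b: "\<And>n. b n \<in> B" "\<And>n. k' n \<in> K"
    "\<And>n. y - real (Suc n) *\<^sub>R h n - k n = b n + k' n"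
    by metis
  let ?s = "\<lambda>n. inverse (real (Suc n)) *\<^sub>R y - inverse (real (Suc n)) *\<^sub>R b n"
  have "\<forall>n. ?s n \<in> H + K"
    using scaled_diff_in_cone_sum[OF K hk(1,2) b(2,3)] by blast
  moreover have "?s \<longlonglongrightarrow> 0 *\<^sub>R y - 0"
    by (intro tendsto_diff tendsto_scaleR_tvs tendsto_scaleR_bounded[OF B(1)]
        LIMSEQ_inverse_real_of_nat tendsto_const b)
  ultimately have "0 \<in> seq_closure (H + K)"
    unfolding seq_closure_def scaleR_zero_left diff_zero mem_Collect_eq
    by (intro exI[of _ ?s] conjI)
  with 0 show False ..
qed

text \<open>Here the factor \<open>r\<close> depends on the neighbourhood, so the neighbourhood is
  fixed first, by openness of the complement of \<open>closure (H + K)\<close>; then a single large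
  n gives the contradiction.\<close>

lemma cond_star_if_cone_bounded:
  fixes K H :: "'y::hausdorff_tvs set"
  assumes K: "convex_cone K" and 0: "0 \<notin> closure (H + K)"
    and bdd: "cone_bounded K (second_union \<A>)"
  shows "cond_star K H \<A>"
proof (rule ccontr)
  assume "\<not> cond_star K H \<A>"
  then obtain y h k where hk: "\<And>n::nat. h n \<in> H" "\<And>n. k n \<in> K"
    "\<And>n. y - real (Suc n) *\<^sub>R h n - k n \<in> second_union \<A>"
    by (rule not_cond_starE) blast
  \<comment> \<open>The three components are the coefficient of \<open>y\<close>, the coefficient of
    \<open>v\<close>, and \<open>v\<close> itself. The two coefficients vary separately because the
    second will contain \<open>r\<close>, which is not yet known.\<close>
  let ?F = "nhds (0::real) \<times>\<^sub>F nhds (0::real) \<times>\<^sub>F nhds (0::'y)"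
  have "((\<lambda>p. fst p *\<^sub>R y - fst (snd p) *\<^sub>R snd (snd p)) \<longlongrightarrow> 0 *\<^sub>R y - 0 *\<^sub>R 0) ?F"
    by (intro tendsto_diff tendsto_scaleR_tvs tendsto_const filterlim_fst
        filterlim_compose[OF filterlim_fst filterlim_snd]
        filterlim_compose[OF filterlim_snd filterlim_snd])
  then have "eventually (\<lambda>p. fst p *\<^sub>R y - fst (snd p) *\<^sub>R snd (snd p) \<in> - closure (H + K)) ?F"
    using 0 by (intro topological_tendstoD) auto
  then obtain P Q R where P: "eventually P (nhds 0)" and Q: "eventually Q (nhds 0)"
    and R: "eventually R (nhds 0)"
    and PQR: "\<And>s t v. P s \<Longrightarrow> Q t \<Longrightarrow> R v \<Longrightarrow> s *\<^sub>R y - t *\<^sub>R v \<notin> closure (H + K)"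
    unfolding eventually_prod_filter by fastforce
  have "0 \<in> interior {v. R v}"
    using R by (auto simp: eventually_nhds interior_def)
  then obtain r where r: "second_union \<A> \<subseteq> (\<lambda>u. r *\<^sub>R u) ` {v. R v} + K"
    using bdd unfolding cone_bounded_def by blast
  have inv: "(\<lambda>n. inverse (real (Suc n))) \<longlonglongrightarrow> 0"
    by (rule LIMSEQ_inverse_real_of_nat)
  then have "(\<lambda>n. inverse (real (Suc n)) * r) \<longlonglongrightarrow> 0"
    by (rule tendsto_mult_left_zero)
  from eventually_conj[OF eventually_compose_filterlim[OF P inv] eventually_compose_filterlim[OF Q this]]
  have "eventually (\<lambda>n. P (inverse (real (Suc n))) \<and> Q (inverse (real (Suc n)) * r)) sequentially" .
  from eventually_happens'[OF sequentially_bot this]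
  obtain n where n: "P (inverse (real (Suc n)))" "Q (inverse (real (Suc n)) * r)"
    by blast
  obtain v k' where v: "R v" "k' \<in> K" "y - real (Suc n) *\<^sub>R h n - k n = r *\<^sub>R v + k'"
    using hk(3)[of n] r by (blast elim: set_plus_elim)
  have "inverse (real (Suc n)) *\<^sub>R y - (inverse (real (Suc n)) * r) *\<^sub>R v \<in> H + K"
    using scaled_diff_in_cone_sum[OF K hk(1,2) v(2,3)] by simp
  then show False
    using PQR[OF n v(1)] closure_subset by blast
qed

section \<open>Functionals in the dual cone, statement (ii)\<close>

lemma dual_cone_diff_le:
  assumes "z \<in> dual_cone K" "k \<in> K"
  shows "z (y - t *\<^sub>R h - k) \<le> z y - t * z h"
proof -
  have "linear z" "0 \<le> z k"
    using assms by (auto simp: dual_cone_def topological_dual_def)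
  then show ?thesis
    by (simp add: linear_diff linear_scale)
qed

text \<open>Each \<open>z (h n)\<close> exceeds a fixed c > 0, so \<open>z\<close> falls at least
  linearly in n along the witnesses, below any lower bound.\<close>

lemma cond_star_if_functional:
  assumes z: "z \<in> dual_cone K" and bdd: "(INF y\<in>second_union \<A>. ereal (z y)) > - \<infinity>"
    and pos: "(INF h\<in>H. ereal (z h)) > 0"
  shows "cond_star K H \<A>"
proof (rule ccontr)
  assume "\<not> cond_star K H \<A>"
  then obtain y h k where hk: "\<And>n::nat. h n \<in> H" "\<And>n. k n \<in> K"
    "\<And>n. y - real (Suc n) *\<^sub>R h n - k n \<in> second_union \<A>"
    by (rule not_cond_starE) blast
  \<comment> \<open>Real numbers strictly below the two extended infima allow the rest to be real
    arithmetic.\<close>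
  obtain m where m: "ereal m < (INF y\<in>second_union \<A>. ereal (z y))"
    using ereal_dense2[OF bdd] by auto
  obtain c where c: "0 < c" "ereal c < (INF h\<in>H. ereal (z h))"
    using ereal_dense2[OF pos] by auto
  have m': "m < z (y - real (Suc n) *\<^sub>R h n - k n)" for n
    using less_le_trans[OF m INF_lower[OF hk(3)[of n]]] by simp
  have c': "c < z (h n)" for n
    using less_le_trans[OF c(2) INF_lower[OF hk(1)[of n]]] by simp
  obtain n :: nat where n: "z y - m < real n * c"
    using reals_Archimedean3[OF c(1)] by blast
  have "m < z y - real (Suc n) * z (h n)"
    using m'[of n] dual_cone_diff_le[OF z hk(2), of y "real (Suc n)" "h n" n] by linarith
  moreover have "real (Suc n) * c \<le> real (Suc n) * z (h n)"
    using c'[of n] by (intro mult_left_mono) auto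
  moreover have "real n * c \<le> real (Suc n) * c"
    using c(1) by (intro mult_right_mono) auto
  ultimately show False
    using n by linarith
qed

text \<open>The functional is chosen after the sequence \<open>h\<close> that comes from the
  failure. A positive limsup bounds \<open>z (h n)\<close> below by some c > 0 only for infinitely
  many n, but one sufficiently large n is enough.\<close>

lemma cond_star_if_dual_cone_bounded:
  assumes bdd: "dual_cone_bounded K (second_union \<A>)"
    and pos: "\<And>h::nat \<Rightarrow> 'y::hausdorff_tvs. (\<And>n. h n \<in> H) \<Longrightarrow>
      \<exists>z\<in>dual_cone K. limsup (\<lambda>n. ereal (z (h n))) > 0"
  shows "cond_star K H \<A>"
proof (rule ccontr)
  assume "\<not> cond_star K H \<A>"
  then obtain y h k where hk: "\<And>n::nat. h n \<in> H" "\<And>n. k n \<in> K"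
    "\<And>n. y - real (Suc n) *\<^sub>R h n - k n \<in> second_union \<A>"
    by (rule not_cond_starE) blast
  obtain z where z: "z \<in> dual_cone K" and lim: "limsup (\<lambda>n. ereal (z (h n))) > 0"
    using pos[of h, OF hk(1)] by (elim bexE)
  obtain c where c: "0 < c" "ereal c < limsup (\<lambda>n. ereal (z (h n)))"
    using ereal_dense2[OF lim] by auto
  obtain m where m: "\<And>e. e \<in> second_union \<A> \<Longrightarrow> m \<le> z e"
    using bdd z unfolding dual_cone_bounded_def bdd_below_def by blast
  obtain N :: nat where N: "z y - m < real N * c"
    using reals_Archimedean3[OF c(1)] by blast
  \<comment> \<open>Otherwise \<open>z (h n)\<close> is at most c from \<open>N\<close> on, and so
    is the limsup.\<close>
  have "\<exists>n\<ge>N. c < z (h n)"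
  proof (rule ccontr)
    assume "\<not> (\<exists>n\<ge>N. c < z (h n))"
    then have "eventually (\<lambda>n. ereal (z (h n)) \<le> ereal c) sequentially"
      unfolding eventually_sequentially by (auto simp: not_less)
    then have "limsup (\<lambda>n. ereal (z (h n))) \<le> ereal c"
      by (rule Limsup_bounded)
    with c(2) show False by simp
  qed
  then obtain n where n: "N \<le> n" "c < z (h n)"
    by blast
  have "m \<le> z y - real (Suc n) * z (h n)"
    using m[OF hk(3)[of n]] dual_cone_diff_le[OF z hk(2), of y "real (Suc n)" "h n" n] by linarith
  moreover have "real N * c \<le> real (Suc n) * z (h n)"
    using n c(1) by (intro mult_mono) auto
  ultimately show False
    using N by linarith
qed

section \<open>Sequentially compact \<open>H\<close>, statement (iii)\<close>

text \<open>Once (b n - y) / (n + 1) + h n lies in \<open>C\<close> for some n, multiplying by n + 1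
  and adding \<open>k n\<close> stays in the cone and puts \<open>b n\<close> into the translate of
  \<open>C\<close> that it was chosen to avoid.\<close>

lemma cond_star_if_seq_compact:
  fixes K H :: "'y::hausdorff_tvs set"
  assumes H: "seq_compact H" and C: "convex_cone C" and B: "tvs_bounded B"
    and KC: "K \<subseteq> C" and HC: "H \<subseteq> interior C"
    and nsub: "\<And>A. A \<in> second_proj \<A> \<Longrightarrow> \<not> B \<subseteq> A + C"
  shows "cond_star K H \<A>"
proof (rule ccontr)
  assume "\<not> cond_star K H \<A>"
  then obtain y h k where hk: "\<And>n::nat. h n \<in> H" "\<And>n. k n \<in> K"
    "\<And>n. y - real (Suc n) *\<^sub>R h n - k n \<in> second_union \<A>"
    by (rule not_cond_starE) blast
  have "\<exists>b\<in>B. b - (y - real (Suc n) *\<^sub>R h n - k n) \<notin> C" for n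
  proof -
    obtain A where A: "A \<in> second_proj \<A>" "y - real (Suc n) *\<^sub>R h n - k n \<in> A"
      using hk(3)[of n] unfolding second_union_def by blast
    obtain b where b: "b \<in> B" "b \<notin> A + C"
      using nsub[OF A(1)] by blast
    have "b - (y - real (Suc n) *\<^sub>R h n - k n) \<notin> C"
    proof
      assume "b - (y - real (Suc n) *\<^sub>R h n - k n) \<in> C"
      from set_plus_intro[OF A(2) this] b(2) show False by simp
    qed
    with b(1) show ?thesis by blast
  qed
  then obtain b where b: "\<And>n. b n \<in> B" "\<And>n. b n - (y - real (Suc n) *\<^sub>R h n - k n) \<notin> C"
    by metis
  obtain l q where l: "l \<in> H" "strict_mono (q :: nat \<Rightarrow> nat)" "(h \<circ> q) \<longlonglongrightarrow> l"
    using seq_compactE[OF H] hk(1) by metis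
  let ?s = "\<lambda>n. inverse (real (Suc n))"
  have "(\<lambda>n. ?s n *\<^sub>R b n - ?s n *\<^sub>R y) \<longlonglongrightarrow> 0 - 0 *\<^sub>R y"
    by (intro tendsto_diff tendsto_scaleR_tvs tendsto_scaleR_bounded[OF B]
        LIMSEQ_inverse_real_of_nat tendsto_const b)
  then have "((\<lambda>n. ?s n *\<^sub>R b n - ?s n *\<^sub>R y) \<circ> q) \<longlonglongrightarrow> 0"
    using l(2) by (simp add: LIMSEQ_subseq_LIMSEQ)
  then have "(\<lambda>i. (?s (q i) *\<^sub>R b (q i) - ?s (q i) *\<^sub>R y) + h (q i)) \<longlonglongrightarrow> 0 + l"
    using l(3) by (intro tendsto_add) (simp_all add: o_def)
  then have "eventually (\<lambda>i. (?s (q i) *\<^sub>R b (q i) - ?s (q i) *\<^sub>R y) + h (q i) \<in> interior C) sequentially"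
    using l(1) HC by (intro topological_tendstoD) auto
  then obtain i where "(?s (q i) *\<^sub>R b (q i) - ?s (q i) *\<^sub>R y) + h (q i) \<in> interior C"
    by (meson eventually_sequentially order_refl)
  \<comment> \<open>The index n is \<open>q i\<close>; the subsequence has served its
    purpose.\<close>
  then obtain n where n: "(?s n *\<^sub>R b n - ?s n *\<^sub>R y) + h n \<in> C"
    using interior_subset by blast
  then have "real (Suc n) *\<^sub>R ((?s n *\<^sub>R b n - ?s n *\<^sub>R y) + h n) + k n \<in> C"
    using C KC hk(2)[of n] by (auto simp: convex_cone_iff)
  moreover have "real (Suc n) *\<^sub>R ((?s n *\<^sub>R b n - ?s n *\<^sub>R y) + h n) + k n
      = b n - (y - real (Suc n) *\<^sub>R h n - k n)"
    by (simp add: scaleR_add_right scaleR_diff_right del: of_nat_Suc)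
  ultimately show False
    using b(2)[of n] by argo
qed

section \<open>Consequences of the condition, statement (iv)\<close>

lemma cond_starD:
  assumes "cond_star K H \<A>"
  obtains \<epsilon> where "\<epsilon> > 0"
    "\<And>A h k. A \<in> second_proj \<A> \<Longrightarrow> h \<in> H \<Longrightarrow> k \<in> K \<Longrightarrow> y - \<epsilon> *\<^sub>R h - k \<notin> A"
  using assms unfolding cond_star_def second_union_def by blast

text \<open>With \<epsilon> taken from the condition at 0, the bounded set is the singleton of
  -\<epsilon> h: writing -\<epsilon> h = a + k would put -\<epsilon> h - k into
  \<open>A\<close>.\<close>

lemma bounded_not_subset_if_cond_star:
  assumes "cond_star K H \<A>" "H \<noteq> {}"
  shows "\<exists>B. tvs_bounded B \<and> (\<forall>A\<in>second_proj \<A>. \<not> B \<subseteq> A + K)"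
proof -
  obtain h where h: "h \<in> H"
    using assms(2) by blast
  obtain \<epsilon> where \<epsilon>: "\<And>A h k. A \<in> second_proj \<A> \<Longrightarrow> h \<in> H \<Longrightarrow> k \<in> K \<Longrightarrow> 0 - \<epsilon> *\<^sub>R h - k \<notin> A"
    using cond_starD[OF assms(1), of 0] by metis
  have "\<not> {0 - \<epsilon> *\<^sub>R h} \<subseteq> A + K" if A: "A \<in> second_proj \<A>" for A
  proof
    assume "{0 - \<epsilon> *\<^sub>R h} \<subseteq> A + K"
    then obtain a k where "a \<in> A" "k \<in> K" "0 - \<epsilon> *\<^sub>R h = a + k"
      by (auto elim!: set_plus_elim)
    then show False
      using \<epsilon>[OF A h, of k] by simp
  qed
  then show ?thesis
    using tvs_bounded_singleton by blast
qed

text \<open>The condition at a single point \<open>y\<close> of \<open>A\<^sub>0\<close> supplies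
  \<epsilon>: a decomposition y = a + \<epsilon> h + k would put y - \<epsilon> h - k into
  \<open>A\<close>.\<close>

lemma not_subset_shift_if_cond_star:
  assumes "cond_star K H \<A>" "A\<^sub>0 \<noteq> {}"
  shows "\<exists>\<epsilon>>0. \<forall>A\<in>second_proj \<A>. \<not> A\<^sub>0 \<subseteq> A + (\<lambda>h. \<epsilon> *\<^sub>R h) ` H + K"
proof -
  obtain y where y: "y \<in> A\<^sub>0"
    using assms(2) by blast
  obtain \<epsilon> where \<epsilon>: "\<epsilon> > 0"
    "\<And>A h k. A \<in> second_proj \<A> \<Longrightarrow> h \<in> H \<Longrightarrow> k \<in> K \<Longrightarrow> y - \<epsilon> *\<^sub>R h - k \<notin> A"
    using cond_starD[OF assms(1), of y] by metis
  have "\<not> A\<^sub>0 \<subseteq> A + (\<lambda>h. \<epsilon> *\<^sub>R h) ` H + K" if A: "A \<in> second_proj \<A>" for A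
  proof
    assume "A\<^sub>0 \<subseteq> A + (\<lambda>h. \<epsilon> *\<^sub>R h) ` H + K"
    with y obtain a h k where "a \<in> A" "h \<in> H" "k \<in> K" "y = a + \<epsilon> *\<^sub>R h + k"
      by (fast elim: set_plus_elim)
    then show False
      using \<epsilon>(2)[OF A, of h k] by simp
  qed
  with \<epsilon>(1) show ?thesis by blast
qed

theorem proposition4p3:
  fixes K H :: "'y::hausdorff_tvs set"
    and \<A> :: "('x::metric_space \<times> 'y set) set"
  assumes "proper_convex_cone K"
    and "H \<subseteq> K - uminus ` K"
    and "H \<noteq> {}"
    and "convex (H + K)"
    and "second_union \<A> \<noteq> {}"
  shows
    \<comment> \<open>(i)\<close>
    "((0 \<notin> seq_closure (H + K) \<and> quasi_cone_bounded K (second_union \<A>)) \<or>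
      (0 \<notin> closure (H + K) \<and> cone_bounded K (second_union \<A>))
        \<longrightarrow> cond_star K H \<A>)
   \<and> \<comment> \<open>(ii)\<close>
     ((\<exists>z\<in>dual_cone K. (INF y\<in>second_union \<A>. ereal (z y)) > - \<infinity> \<and> (INF h\<in>H. ereal (z h)) > 0) \<or>
      (dual_cone_bounded K (second_union \<A>) \<and>
       (\<forall>h::nat \<Rightarrow> 'y. (\<forall>n. h n \<in> H) \<longrightarrow> (\<exists>z\<in>dual_cone K. limsup (\<lambda>n. ereal (z (h n))) > 0)))
        \<longrightarrow> cond_star K H \<A>)
   \<and> \<comment> \<open>(iii)\<close>
     (seq_compact H \<longrightarrow>
       ((\<exists>C B. convex_cone C \<and> tvs_bounded B \<and> K \<subseteq> C \<and> H \<subseteq> interior C \<and>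
               (\<forall>A\<in>second_proj \<A>. \<not> B \<subseteq> A + C))
          \<longrightarrow> cond_star K H \<A>) \<and>
       (H \<subseteq> interior K \<and> (\<exists>B. tvs_bounded B \<and> (\<forall>A\<in>second_proj \<A>. \<not> B \<subseteq> A + K))
          \<longrightarrow> cond_star K H \<A>))
   \<and> \<comment> \<open>(iv)\<close>
     (cond_star K H \<A> \<longrightarrow>
       (\<exists>B. tvs_bounded B \<and> (\<forall>A\<in>second_proj \<A>. \<not> B \<subseteq> A + K)) \<and>
       (\<forall>A\<^sub>0\<in>second_proj \<A>. A\<^sub>0 \<noteq> {} \<longrightarrow>
          (\<exists>\<epsilon>>0. \<forall>A\<in>second_proj \<A>. \<not> A\<^sub>0 \<subseteq> A + (\<lambda>h. \<epsilon> *\<^sub>R h) ` H + K)))"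
proof -
  have K: "convex_cone K"
    using assms(1) by (simp add: proper_convex_cone_def)
  show ?thesis
  proof (intro conjI impI ballI)
    assume "0 \<notin> seq_closure (H + K) \<and> quasi_cone_bounded K (second_union \<A>) \<or>
      0 \<notin> closure (H + K) \<and> cone_bounded K (second_union \<A>)"
    then show "cond_star K H \<A>"
      using cond_star_if_quasi_cone_bounded[OF K] cond_star_if_cone_bounded[OF K] by blast
  next
    assume "(\<exists>z\<in>dual_cone K. (INF y\<in>second_union \<A>. ereal (z y)) > - \<infinity> \<and> (INF h\<in>H. ereal (z h)) > 0) \<or>
      (dual_cone_bounded K (second_union \<A>) \<and>
       (\<forall>h::nat \<Rightarrow> 'y. (\<forall>n. h n \<in> H) \<longrightarrow> (\<exists>z\<in>dual_cone K. limsup (\<lambda>n. ereal (z (h n))) > 0)))"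
    then show "cond_star K H \<A>"
    proof (elim disjE bexE conjE)
      fix z
      assume "z \<in> dual_cone K" "(INF y\<in>second_union \<A>. ereal (z y)) > - \<infinity>"
        "(INF h\<in>H. ereal (z h)) > 0"
      then show ?thesis by (rule cond_star_if_functional)
    next
      assume "dual_cone_bounded K (second_union \<A>)"
        "\<forall>h::nat \<Rightarrow> 'y. (\<forall>n. h n \<in> H) \<longrightarrow> (\<exists>z\<in>dual_cone K. limsup (\<lambda>n. ereal (z (h n))) > 0)"
      then show ?thesis by (intro cond_star_if_dual_cone_bounded) simp_all
    qed
  next
    assume "seq_compact H" "\<exists>C B. convex_cone C \<and> tvs_bounded B \<and> K \<subseteq> C \<and> H \<subseteq> interior C \<and>
      (\<forall>A\<in>second_proj \<A>. \<not> B \<subseteq> A + C)"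
    then show "cond_star K H \<A>"
      using cond_star_if_seq_compact by blast
  next
    assume "seq_compact H"
      "H \<subseteq> interior K \<and> (\<exists>B. tvs_bounded B \<and> (\<forall>A\<in>second_proj \<A>. \<not> B \<subseteq> A + K))"
    \<comment> \<open>This is the case C = K.\<close>
    then show "cond_star K H \<A>"
      using cond_star_if_seq_compact[OF _ K _ order_refl] by blast
  next
    assume "cond_star K H \<A>"
    then show "\<exists>B. tvs_bounded B \<and> (\<forall>A\<in>second_proj \<A>. \<not> B \<subseteq> A + K)"
      using assms(3) by (rule bounded_not_subset_if_cond_star)
  next
    fix A\<^sub>0 :: "'y set"
    assume "cond_star K H \<A>" "A\<^sub>0 \<noteq> {}"
    then show "\<exists>\<epsilon>>0. \<forall>A\<in>second_proj \<A>. \<not> A\<^sub>0 \<subseteq> A + (\<lambda>h. \<epsilon> *\<^sub>R h) ` H + K"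
      by (rule not_subset_shift_if_cond_star)
  qed
qed

end
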